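(* Let $G$ be a complete bipartite graph with $n$ vertices. Then $$\frac2n\sqrt{(n-1)(n^2-2n+2)}\leq E_{DSO}(G)\leq\frac2n\sqrt{\left\lceil\frac n2\right\rceil^3\left\lfloor\frac n2\right\rfloor+\left\lceil\frac n2\right\rceil\left\lfloor\frac n2\right\rfloor^3}.$$ Equality on the left holds if and only if $G\cong K_{1,n-1}$, and equality on the right holds if and only if $G\cong K_{\lceil n/2\rceil,\lfloor n/2\rfloor}$.
   Context: A complete bipartite graph is $K_{p,q}$ with both parts nonempty ($p,q\geq1$, $p+q=n$). For a finite simple graph $G$ with vertices $v_1,\dots,v_n$ and degrees $d_i=d_{v_i}$, the diminished Sombor matrix $M_{DS}(G)=(\mu_{ij})$ is the $n\times n$ real symmetric matrix with $\mu_{ij}=\frac{\sqrt{d_i^2+d_j^2}}{d_i+d_j}$ if $v_iv_j\in E(G)$, and $\mu_{ij}=0$ otherwise. If $\lambda_1\geq\cdots\geq\lambda_n$ are its eigenvalues, the diminished Sombor energy is $E_{DSO}(G)=\sum_{i=1}^n|\lambda_i|$. *)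

theory Defs
  imports
    Complex_Main
    "Jordan_Normal_Form.Char_Poly"
    "Graph_Theory.Graph_Theory"
begin

text \<open>
  Finite simple graphs are the \<^locale>\<open>graph\<close>s of the library: finite symmetric digraphs
  without loops and parallel arcs. An edge is a pair of opposite arcs, so the degree of a vertex
  is its out-degree.
\<close>

text \<open>
  The list \<open>vs\<close> is the enumeration \<open>v\<^sub>1, \<dots>, v\<^sub>n\<close> of the vertices that indexes rows and columns.
\<close>

definition DS_matrix :: "('a, 'b) pre_digraph \<Rightarrow> 'a list \<Rightarrow> real mat" where
  "DS_matrix G vs = mat (length vs) (length vs) (\<lambda>(i, j).
     let d = (\<lambda>k. real (out_degree G (vs ! k)))
     in if vs ! i \<rightarrow>\<^bsub>G\<^esub> vs ! j then sqrt ((d i)\<^sup>2 + (d j)\<^sup>2) / (d i + d j) else 0)"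

text \<open>
  The multiset of real roots of the characteristic polynomial lists the eigenvalues with
  multiplicity. It has \<open>n\<close> elements because the matrix is real and symmetric.
\<close>

definition DSO_energy :: "('a, 'b) pre_digraph \<Rightarrow> 'a list \<Rightarrow> real" where
  "DSO_energy G vs = (\<Sum>x\<in>#proots (char_poly (DS_matrix G vs)). \<bar>x\<bar>)"

definition complete_bipartite_graph :: "nat \<Rightarrow> nat \<Rightarrow> (nat + nat, (nat + nat) \<times> (nat + nat)) pre_digraph" where
  "complete_bipartite_graph p q =
     (let U = Inl ` {..<p}; V = Inr ` {..<q}
      in with_proj \<lparr> pverts = U \<union> V, parcs = U \<times> V \<union> V \<times> U \<rparr>)"

definition is_complete_bipartite :: "('a, 'b) pre_digraph \<Rightarrow> bool" where
  "is_complete_bipartite G \<longleftrightarrow>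
     (\<exists>p q. p \<ge> 1 \<and> q \<ge> 1 \<and> digraph_iso G (complete_bipartite_graph p q))"

text \<open>The library characterises the graphs isomorphic to this one by a predicate.\<close>

lemma complete_bipartite_digraph_complete_bipartite_graph:
  "complete_bipartite_digraph p q (complete_bipartite_graph p q)"
proof -
  let ?U = "Inl ` {..<p} :: (nat + nat) set" and ?V = "Inr ` {..<q} :: (nat + nat) set"
  let ?E = "?U \<times> ?V \<union> ?V \<times> ?U"
  have "card ?U = p" "card ?V = q"
    by (simp_all add: card_image)
  moreover have "?U \<inter> ?V = {}"
    by auto
  ultimately have "\<exists>U V. ?U \<union> ?V = U \<union> V \<and> U \<inter> V = {} \<and> card U = p \<and> card V = q
      \<and> ?E = U \<times> V \<union> V \<times> U"
    by blast
  moreover have "finite (?U \<union> ?V)"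
    by simp
  ultimately show ?thesis
    unfolding complete_bipartite_graph_def Let_def complete_bipartite_digraph_pair_def
      pair_pre_digraph.simps by blast
qed

lemma digraph_iso_complete_bipartite_graph_iff:
  assumes "graph G"
  shows "digraph_iso G (complete_bipartite_graph p q) \<longleftrightarrow> complete_bipartite_digraph p q G"
proof
  interpret graph G by fact
  assume "digraph_iso G (complete_bipartite_graph p q)"
  then obtain f where f: "digraph_isomorphism f" "complete_bipartite_graph p q = app_iso f G"
    unfolding digraph_iso_def by blast
  let ?h = "iso_verts f"
  let ?K = "complete_bipartite_graph p q"
  from complete_bipartite_digraph_complete_bipartite_graph[of p q]
  obtain U V where UV: "verts ?K = U \<union> V" "U \<inter> V = {}" "card U = p" "card V = q"
     "arcs_ends ?K = U \<times> V \<union> V \<times> U"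
    unfolding complete_bipartite_digraph_def by blast
  have inj: "inj_on ?h (verts G)" using f(1) by (simp add: digraph_isomorphism_def)
  have im: "verts ?K = ?h ` verts G" using f(2) by simp
  have ends: "arcs_ends ?K = (\<lambda>(u, v). (?h u, ?h v)) ` arcs_ends G"
    using f(1) unfolding f(2) arcs_ends_conv digraph_isomorphism_def
    by (simp add: image_image)
  let ?U = "{x \<in> verts G. ?h x \<in> U}" and ?V = "{x \<in> verts G. ?h x \<in> V}"
  have h_im: "?h ` ?U = U" "?h ` ?V = V" using im UV(1) by auto
  have "inj_on ?h ?U" "inj_on ?h ?V" using inj by (auto intro: inj_on_subset)
  from card_image[OF this(1)] card_image[OF this(2)]
  have c: "card ?U = p" "card ?V = q" unfolding h_im UV(3,4) by simp_all
  have "(u, v) \<in> arcs_ends G \<longleftrightarrow> (u, v) \<in> ?U \<times> ?V \<union> ?V \<times> ?U" for u v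
  proof
    assume e: "(u, v) \<in> arcs_ends G"
    then have uv: "u \<in> verts G" "v \<in> verts G" by (auto simp: arcs_ends_conv)
    have "(?h u, ?h v) \<in> arcs_ends ?K" using e unfolding ends by force
    then show "(u, v) \<in> ?U \<times> ?V \<union> ?V \<times> ?U" using uv unfolding UV(5) by simp
  next
    assume "(u, v) \<in> ?U \<times> ?V \<union> ?V \<times> ?U"
    then have "(?h u, ?h v) \<in> arcs_ends ?K" and uv: "u \<in> verts G" "v \<in> verts G"
      unfolding UV(5) by auto
    then obtain u' v' where e: "(u', v') \<in> arcs_ends G" "?h u = ?h u'" "?h v = ?h v'"
      unfolding ends by auto
    then have "u' \<in> verts G" "v' \<in> verts G" by (auto simp: arcs_ends_conv)
    then have "u' = u" "v' = v" using e uv inj by (auto dest: inj_onD)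
    then show "(u, v) \<in> arcs_ends G" using e by simp
  qed
  then have "arcs_ends G = ?U \<times> ?V \<union> ?V \<times> ?U" by (simp add: set_eq_iff split_paired_all)
  moreover have "verts G = ?U \<union> ?V" using im UV(1) by auto
  moreover have "?U \<inter> ?V = {}" using UV(2) by auto
  ultimately show "complete_bipartite_digraph p q G"
    unfolding complete_bipartite_digraph_def using assms c by blast
next
  interpret graph G by fact
  assume "complete_bipartite_digraph p q G"
  then obtain U V where UV: "verts G = U \<union> V" "U \<inter> V = {}" "card U = p" "card V = q"
     "arcs_ends G = U \<times> V \<union> V \<times> U"
    unfolding complete_bipartite_digraph_def by blast
  have "finite U" "finite V" using finite_verts UV(1) by auto
  then obtain a b where a: "bij_betw a U {..<p}" and b: "bij_betw b V {..<q}"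
    using UV(3,4) ex_bij_betw_finite_nat by (metis atLeast0LessThan)
  define h where "h x = (if x \<in> U then Inl (a x) else Inr (b x))" for x
  define f where "f = \<lparr> iso_verts = h, iso_arcs = (\<lambda>e. (h (tail G e), h (head G e))),
    iso_head = snd, iso_tail = fst \<rparr>"
  have "h ` U = Inl ` a ` U" by (simp add: h_def image_image)
  then have hU: "h ` U = Inl ` {..<p}" using a by (simp add: bij_betw_def)
  have "h x = Inr (b x)" if "x \<in> V" for x using that UV(2) by (auto simp: h_def)
  then have "h ` V = Inr ` b ` V" by (simp add: image_image)
  then have hV: "h ` V = Inr ` {..<q}" using b by (simp add: bij_betw_def)
  have inj: "inj_on h (verts G)"
    using a b UV(1,2) by (auto simp: h_def inj_on_def bij_betw_def)
  have "inj_on (\<lambda>e. (h (tail G e), h (head G e))) (arcs G)"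
    using inj no_multi_arcs by (auto simp: inj_on_def arc_to_ends_def)
  then have "digraph_isomorphism f"
    using inj by (simp add: digraph_isomorphism_def f_def wf_digraph)
  moreover have "(\<lambda>e. (h (tail G e), h (head G e))) ` arcs G
      = (\<lambda>(u, v). (h u, h v)) ` arcs_ends G"
    by (simp add: arcs_ends_conv image_image)
  then have "(\<lambda>e. (h (tail G e), h (head G e))) ` arcs G = h ` U \<times> h ` V \<union> h ` V \<times> h ` U"
    unfolding UV(5) by force
  then have "complete_bipartite_graph p q = app_iso f G"
    by (simp add: complete_bipartite_graph_def with_proj_def app_iso_def f_def UV(1) image_Un hU hV)
  ultimately show "digraph_iso G (complete_bipartite_graph p q)"
    unfolding digraph_iso_def by blast
qed

end

theory Submission
  imports Defs
begin

text \<open>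
  The diminished Sombor matrix of \<open>K\<^bsub>p,q\<^esub>\<close> is a constant \<open>w\<close> times the adjacency matrix,
  which factors through dimension two. By Sylvester's determinant identity its nonzero eigenvalues
  are \<open>\<plusminus> w \<surd>(pq)\<close>, so the energy is \<open>2/n \<surd>(pq (p\<^sup>2 + q\<^sup>2))\<close>. In terms of
  \<open>x = pq\<close> the radicand is \<open>x (n\<^sup>2 - 2x)\<close>, which is strictly increasing for \<open>x \<le> n\<^sup>2/4\<close>; and
  \<open>x\<close> ranges between \<open>n - 1\<close> and \<open>\<lceil>n/2\<rceil>\<lfloor>n/2\<rfloor>\<close>, each value being attained
  by only one unordered pair.
\<close>

section \<open>Characteristic polynomials of products\<close>

text \<open>Both sides compute \<open>x^n * det P\<close> for the block matrix \<open>P\<close> with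
  rows (x I, A) and (B, I): clearing its lower left block from the right leaves x I - A B, from the
  left x I - B A. The powers of x keep the identity free of division and of any assumption on m and
  n.\<close>

lemma char_poly_mult_commute:
  fixes A :: "'a :: idom mat"
  assumes A: "A \<in> carrier_mat m n" and B: "B \<in> carrier_mat n m"
  shows "[:0, 1:] ^ n * char_poly (A * B) = [:0, 1:] ^ m * char_poly (B * A)"
proof -
  let ?c = "\<lambda>a :: 'a. [:a:]"
  let ?x = "[:0, 1 :: 'a:]"
  define A' where "A' = map_mat ?c A"
  define B' where "B' = map_mat ?c B"
  interpret c: comm_ring_hom ?c by unfold_locales (auto simp: one_pCons)
  have A': "A' \<in> carrier_mat m n" and B': "B' \<in> carrier_mat n m"
    using A B by (auto simp: A'_def B'_def)
  have AB: "char_poly_matrix (A * B) = ?x \<cdot>\<^sub>m 1\<^sub>m m - A' * B'"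
    unfolding char_poly_matrix_def A'_def B'_def c.mat_hom_mult[OF A B, symmetric]
    using A B by (intro eq_matI) auto
  have BA: "char_poly_matrix (B * A) = ?x \<cdot>\<^sub>m 1\<^sub>m n - B' * A'"
    unfolding char_poly_matrix_def A'_def B'_def c.mat_hom_mult[OF B A, symmetric]
    using A B by (intro eq_matI) auto
  have blk: "?x \<cdot>\<^sub>m 1\<^sub>m m - A' * B' \<in> carrier_mat m m"
      "?x \<cdot>\<^sub>m 1\<^sub>m n - B' * A' \<in> carrier_mat n n"
    using A' B' by auto
  define P where "P = four_block_mat (?x \<cdot>\<^sub>m 1\<^sub>m m) A' B' (1\<^sub>m n)"
  let ?L = "four_block_mat (1\<^sub>m m) (0\<^sub>m m n) (- B') (1\<^sub>m n)"
  \<comment> \<open>The lower right block x I makes the lower left block of \<open>?R * P\<close>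
    cancel as - x B' + x B'. This costs the factor \<open>x^n\<close> in the determinant, whereas
    \<open>?L\<close> has determinant 1.\<close>
  let ?R = "four_block_mat (1\<^sub>m m) (0\<^sub>m m n) (- B') (?x \<cdot>\<^sub>m 1\<^sub>m n)"
  have P: "P \<in> carrier_mat (m + n) (m + n)"
    unfolding P_def by (rule four_block_carrier_mat) auto
  have L: "?L \<in> carrier_mat (m + n) (m + n)" "?R \<in> carrier_mat (m + n) (m + n)"
    by (rule four_block_carrier_mat; simp)+
  have "P * ?L = four_block_mat (?x \<cdot>\<^sub>m 1\<^sub>m m - A' * B') A' (0\<^sub>m n m) (1\<^sub>m n)"
    unfolding P_def
    by (subst mult_four_block_mat[where ?n1.0 = m and ?n2.0 = n])
      (use A' B' in \<open>auto intro!: arg_cong2[where f = "\<lambda>x y. four_block_mat x y _ _"]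
         arg_cong2[where f = "four_block_mat _ _"] eq_matI\<close>)
  then have "det (P * ?L) = char_poly (A * B) * det (1\<^sub>m n)"
    unfolding char_poly_def AB
    by (simp only: det_four_block_mat_lower_left_zero[OF blk(1) A' refl one_carrier_mat])
  moreover have "det (P * ?L) = det P"
    unfolding det_mult[OF P L(1)]
    by (subst det_four_block_mat_upper_right_zero[where n = m and m = n]) (use B' in auto)
  ultimately have 1: "det P = char_poly (A * B)"
    by simp
  have "?R * P = four_block_mat (?x \<cdot>\<^sub>m 1\<^sub>m m) A' (0\<^sub>m n m) (?x \<cdot>\<^sub>m 1\<^sub>m n - B' * A')"
    unfolding P_def
    by (subst mult_four_block_mat[where ?n1.0 = m and ?n2.0 = n])
      (use A' B' in \<open>auto intro!: arg_cong2[where f = "four_block_mat _ _"] eq_matI\<close>)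
  then have "det (?R * P) = det (?x \<cdot>\<^sub>m 1\<^sub>m m) * char_poly (B * A)"
    unfolding char_poly_def BA
    by (simp only: det_four_block_mat_lower_left_zero
        [OF smult_carrier_mat[OF one_carrier_mat] A' refl blk(2)])
  moreover have "det (?R * P) = ?x ^ n * det P"
    unfolding det_mult[OF L(2) P]
    by (subst det_four_block_mat_upper_right_zero[where n = m and m = n]) (use B' in auto)
  ultimately show ?thesis
    by (simp add: 1)
qed

text \<open>The small product is antidiagonal, so its characteristic polynomial is
  \<open>x^2 - a * b\<close>. Passing to \<open>B * C\<close> only changes the multiplicity of the
  root 0, which a sum of absolute values does not see.\<close>

lemma sum_abs_proots_char_poly_mult:
  fixes B :: "real mat"
  assumes B: "B \<in> carrier_mat n 2" and C: "C \<in> carrier_mat 2 n"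
    and CB: "C * B = mat 2 2 (\<lambda>(i, j). if i = j then 0 else if i = 0 then a else b)"
    and ab: "a * b \<ge> 0"
  shows "(\<Sum>x\<in>#proots (char_poly (B * C)). \<bar>x\<bar>) = 2 * sqrt (a * b)"
proof -
  let ?s = "sqrt (a * b)"
  have "char_poly (C * B) = [:- ?s, 1:] * [:?s, 1:]"
    unfolding CB char_poly_def using ab
    by (subst laplace_expansion_row[where n = 2 and i = 0])
      (auto simp: char_poly_matrix_def lessThan_Suc numeral_2_eq_2 cofactor_def det_single mat_delete_def)
  then have eq: "[:0, 1:] ^ 2 * char_poly (B * C) = [:0, 1:] ^ n * ([:- ?s, 1:] * [:?s, 1:])"
    using char_poly_mult_commute[OF B C] by simp
  \<comment> \<open>The roots of a product split into those of the factors once the factors are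
    nonzero; for \<open>char_poly (B * C)\<close> this is read off from the identity.\<close>
  have "[:0, 1:] ^ n * ([:- ?s, 1:] * [:?s, 1:]) \<noteq> 0"
    by (simp del: mult_pCons_left mult_pCons_right)
  with eq have "char_poly (B * C) \<noteq> 0"
    by (metis mult_zero_right)
  then have "(\<Sum>x\<in>#proots ([:0, 1:] ^ 2 * char_poly (B * C)). \<bar>x\<bar>)
      = (\<Sum>x\<in>#proots (char_poly (B * C)). \<bar>x\<bar>)"
    by (subst proots_mult) (auto simp: proots_power)
  moreover have "(\<Sum>x\<in>#proots ([:0, 1:] ^ n * ([:- ?s, 1:] * [:?s, 1:])). \<bar>x\<bar>) = 2 * ?s"
    using ab by (auto simp: proots_power proots_mult simp del: mult_pCons_left mult_pCons_right)
  ultimately show ?thesis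
    using eq by simp
qed

section \<open>Energy of complete bipartite graphs\<close>

lemma (in graph) out_degree_eq_card_dominated:
  "out_degree G v = card {u. v \<rightarrow>\<^bsub>G\<^esub> u}"
proof -
  have "bij_betw (head G) (out_arcs G v) {u. v \<rightarrow>\<^bsub>G\<^esub> u}"
    using no_multi_arcs unfolding bij_betw_def inj_on_def
    by (auto simp: arcs_ends_conv arc_to_ends_def)
  then show ?thesis
    by (simp add: out_degree_def bij_betw_same_card)
qed

text \<open>Every edge joins a vertex of degree q to one of degree p, so all nonzero entries equal
  the same \<open>w\<close>, whatever the enumeration \<open>vs\<close>. The 2 by 2 product
  \<open>C * B\<close> then has off-diagonal entries \<open>w * q\<close> and
  \<open>w * p\<close>.\<close>

lemma DSO_energy_complete_bipartite:
  assumes G: "graph G" and iso: "digraph_iso G (complete_bipartite_graph p q)"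
    and vs: "distinct vs" "set vs = verts G"
  shows "card (verts G) = p + q"
    and "DSO_energy G vs = 2 / (real p + q) * sqrt (real p * q * ((real p)\<^sup>2 + (real q)\<^sup>2))"
proof -
  interpret graph G by fact
  from iso obtain U V where UV: "verts G = U \<union> V" "U \<inter> V = {}" "card U = p" "card V = q"
      "arcs_ends G = U \<times> V \<union> V \<times> U"
    unfolding digraph_iso_complete_bipartite_graph_iff[OF G] complete_bipartite_digraph_def
    by blast
  have fin: "finite U" "finite V"
    using finite_verts UV(1) by auto
  show "card (verts G) = p + q"
    using UV fin by (simp add: card_Un_disjoint)
  define n where "n = length vs"
  define w where "w = sqrt ((real p)\<^sup>2 + (real q)\<^sup>2) / (real p + q)"
  have deg: "v \<in> U \<Longrightarrow> out_degree G v = q" "v \<in> V \<Longrightarrow> out_degree G v = p" for v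
  proof -
    have "v \<in> U \<Longrightarrow> {u. v \<rightarrow>\<^bsub>G\<^esub> u} = V" "v \<in> V \<Longrightarrow> {u. v \<rightarrow>\<^bsub>G\<^esub> u} = U"
      using UV(2,5) by auto
    then show "v \<in> U \<Longrightarrow> out_degree G v = q" "v \<in> V \<Longrightarrow> out_degree G v = p"
      using UV(3,4) by (simp_all add: out_degree_eq_card_dominated)
  qed
  have side: "vs ! i \<in> U \<longleftrightarrow> vs ! i \<notin> V" if "i < n" for i
    using that vs(2) UV(1,2) nth_mem[of i vs] unfolding n_def by blast
  \<comment> \<open>The columns of \<open>B\<close> are the indicators of U and V; the rows of
    \<open>C\<close> are \<open>w\<close> times the indicators of V and U, in this swapped order
    because edges run between the parts.\<close>
  define B where "B = mat n 2 (\<lambda>(i, j). if (vs ! i \<in> U) = (j = 0) then 1 else 0 :: real)"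
  define C where "C = mat 2 n (\<lambda>(j, i). if (vs ! i \<in> U) = (j = 0) then 0 else w)"
  have B: "B \<in> carrier_mat n 2" and C: "C \<in> carrier_mat 2 n"
    by (auto simp: B_def C_def)
  have M: "DS_matrix G vs = B * C"
  proof (rule eq_matI)
    fix i j assume "i < dim_row (B * C)" "j < dim_col (B * C)"
    then have ij: "i < n" "j < n"
      by (auto simp: B_def C_def)
    then show "DS_matrix G vs $$ (i, j) = (B * C) $$ (i, j)"
      using side[OF ij(1)] side[OF ij(2)] UV(2)
      by (auto simp: DS_matrix_def B_def C_def n_def[symmetric] scalar_prod_def Let_def UV(5) deg
          w_def numeral_2_eq_2 add.commute)
  qed (auto simp: DS_matrix_def B_def C_def n_def)
  have sum_vs: "(\<Sum>i<n. f (vs ! i)) = (\<Sum>x\<in>U \<union> V. f x)" for f :: "_ \<Rightarrow> real"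
    using sum.reindex_bij_betw[OF bij_betw_nth[OF vs(1) refl refl], of f] vs(2) UV(1)
    by (simp add: n_def)
  have sums: "(\<Sum>i<n. if vs ! i \<in> U then w else 0) = w * p"
      "(\<Sum>i<n. if vs ! i \<in> U then 0 else w) = w * q"
  proof -
    have "(\<Sum>x\<in>V. if x \<in> U then w else 0) = (\<Sum>x\<in>V. 0)"
      "(\<Sum>x\<in>V. if x \<in> U then 0 else w) = (\<Sum>x\<in>V. w)"
      by (intro sum.cong refl; use UV(2) in auto)+
    then show "(\<Sum>i<n. if vs ! i \<in> U then w else 0) = w * p"
      "(\<Sum>i<n. if vs ! i \<in> U then 0 else w) = w * q"
      using fin UV(2-4)
      by (simp_all add: sum_vs[of "\<lambda>x. if x \<in> U then w else 0"]
          sum_vs[of "\<lambda>x. if x \<in> U then 0 else w"] sum.union_disjoint)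
  qed
  have CB: "C * B = mat 2 2 (\<lambda>(i, j). if i = j then 0 else if i = 0 then w * q else w * p)"
  proof (rule eq_matI)
    fix i j :: nat
    assume "i < dim_row (mat 2 2 (\<lambda>(i, j). if i = j then 0 else if i = 0 then w * q else w * p))"
      "j < dim_col (mat 2 2 (\<lambda>(i, j). if i = j then 0 else if i = 0 then w * q else w * p))"
    then have ij: "i < 2" "j < 2"
      by auto
    have "(C * B) $$ (i, j) = (\<Sum>k<n. (if (vs ! k \<in> U) = (i = 0) then 0 else w)
        * (if (vs ! k \<in> U) = (j = 0) then 1 else 0))"
      using ij by (simp add: B_def C_def scalar_prod_def atLeast0LessThan)
    \<comment> \<open>On the diagonal the supports are the disjoint parts U and V, so every summand
      vanishes.\<close>
    also have "\<dots> = (if i = j then 0 else if i = 0 then \<Sum>k<n. if vs ! k \<in> U then 0 else w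
        else \<Sum>k<n. if vs ! k \<in> U then w else 0)"
      using ij by (auto intro!: sum.neutral sum.cong simp: less_2_cases_iff)
    finally show "(C * B) $$ (i, j)
        = mat 2 2 (\<lambda>(i, j). if i = j then 0 else if i = 0 then w * q else w * p) $$ (i, j)"
      using ij by (simp add: sums)
  qed (auto simp: B_def C_def)
  have "w \<ge> 0"
    by (simp add: w_def)
  have "DSO_energy G vs = 2 * sqrt ((w * q) * (w * p))"
    unfolding DSO_energy_def M
    by (rule sum_abs_proots_char_poly_mult[OF B C CB]) (use \<open>w \<ge> 0\<close> in simp)
  also have "(w * q) * (w * p) = w\<^sup>2 * (real p * q)"
    by (simp add: power2_eq_square)
  also have "sqrt \<dots> = w * sqrt (real p * q)"
    using \<open>w \<ge> 0\<close> by (simp add: real_sqrt_mult)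
  finally show "DSO_energy G vs = 2 / (real p + q) * sqrt (real p * q * ((real p)\<^sup>2 + (real q)\<^sup>2))"
    by (simp add: w_def real_sqrt_mult)
qed

section \<open>Comparison of the possible part sizes\<close>

lemma digraph_iso_complete_bipartite_graph_commute:
  assumes "graph G"
  shows "digraph_iso G (complete_bipartite_graph p q) \<longleftrightarrow> digraph_iso G (complete_bipartite_graph q p)"
  unfolding digraph_iso_complete_bipartite_graph_iff[OF assms] complete_bipartite_digraph_def
  by (metis Int_commute Un_commute)

text \<open>With s the common sum and x, y the two products, the difference of the values is
  \<open>(y - x) * (s^2 - 2 * x - 2 * y)\<close>. The second factor is the mean of
  \<open>s^2 - 4 * x\<close> and \<open>s^2 - 4 * y\<close>, both squares, and vanishes only if both
  do, that is, if x = y.\<close>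

lemma mult_sum_squares_le_iff:
  fixes p q p' q' :: nat
  assumes "p + q = p' + q'"
  shows "real p * q * ((real p)\<^sup>2 + (real q)\<^sup>2) \<le> real p' * q' * ((real p')\<^sup>2 + (real q')\<^sup>2)
    \<longleftrightarrow> p * q \<le> p' * q'"
proof -
  define s where "s = real p + q"
  define x where "x = real p * q"
  define y where "y = real p' * q'"
  have s: "s = real p' + q'"
    using assms by (simp add: s_def flip: of_nat_add)
  have f: "real p * q * ((real p)\<^sup>2 + (real q)\<^sup>2) = x * (s\<^sup>2 - 2 * x)"
    "real p' * q' * ((real p')\<^sup>2 + (real q')\<^sup>2) = y * (s\<^sup>2 - 2 * y)"
    by (simp add: s_def x_def power2_eq_square algebra_simps)
      (simp add: s y_def power2_eq_square algebra_simps)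
  have "s\<^sup>2 - 4 * x = (real p - q)\<^sup>2" "s\<^sup>2 - 4 * y = (real p' - q')\<^sup>2"
    by (simp add: s_def x_def power2_eq_square algebra_simps)
      (simp add: s y_def power2_eq_square algebra_simps)
  then have "s\<^sup>2 - 4 * x \<ge> 0" "s\<^sup>2 - 4 * y \<ge> 0"
    by simp_all
  then have pos: "x = y \<or> s\<^sup>2 - 2 * x - 2 * y > 0"
    by argo
  have "y * (s\<^sup>2 - 2 * y) - x * (s\<^sup>2 - 2 * x) = (y - x) * (s\<^sup>2 - 2 * x - 2 * y)"
    by (simp add: algebra_simps power2_eq_square)
  then have "x * (s\<^sup>2 - 2 * x) \<le> y * (s\<^sup>2 - 2 * y) \<longleftrightarrow> (y - x) * (s\<^sup>2 - 2 * x - 2 * y) \<ge> 0"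
    by linarith
  also have "\<dots> \<longleftrightarrow> x \<le> y"
    using pos by (auto simp: zero_le_mult_iff)
  also have "\<dots> \<longleftrightarrow> p * q \<le> p' * q'"
    by (simp add: x_def y_def flip: of_nat_mult)
  finally show ?thesis
    unfolding f .
qed

text \<open>By Vieta, p is a root of the quadratic with roots p' and q'.\<close>

lemma eq_pair_if_sum_prod_eq:
  fixes p q p' q' :: nat
  assumes "p + q = p' + q'" "p * q = p' * q'"
  shows "p = p' \<and> q = q' \<or> p = q' \<and> q = p'"
proof -
  have s: "int p + q = int p' + q'" and m: "int p * q = int p' * q'"
    using assms by (simp_all flip: of_nat_add of_nat_mult)
  have "(int p - p') * (int p - q') = int p * p - int p * (int p' + q') + int p' * q'"
    by (simp add: algebra_simps)
  also have "\<dots> = 0"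
    unfolding s[symmetric] m[symmetric] by (simp add: algebra_simps)
  finally have "p = p' \<or> p = q'"
    by simp
  then show ?thesis
    using assms(1) by auto
qed

theorem corollary4p4:
  fixes G :: "('a, 'b) pre_digraph" and vs :: "'a list" and n :: nat
  assumes "graph G"
    and "is_complete_bipartite G"
    and "distinct vs" and "set vs = verts G"
    and "n = card (verts G)"
  shows
    "let E = DSO_energy G vs;
         a = \<lceil>real n / 2\<rceil>;
         b = \<lfloor>real n / 2\<rfloor>;
         L = 2 / real n * sqrt ((real n - 1) * ((real n)\<^sup>2 - 2 * real n + 2));
         R = 2 / real n * sqrt (real_of_int a ^ 3 * real_of_int b + real_of_int a * real_of_int b ^ 3)
     in L \<le> E \<and> E \<le> R
        \<and> (L = E \<longleftrightarrow> digraph_iso G (complete_bipartite_graph 1 (n - 1)))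
        \<and> (E = R \<longleftrightarrow> digraph_iso G (complete_bipartite_graph (nat a) (nat b)))"
proof -
  from assms(2) obtain p q where pq: "p \<ge> 1" "q \<ge> 1"
      and iso: "digraph_iso G (complete_bipartite_graph p q)"
    unfolding is_complete_bipartite_def by blast
  define e where "e p q = 2 / (real p + q) * sqrt (real p * q * ((real p)\<^sup>2 + (real q)\<^sup>2))" for p q
  \<comment> \<open>The isomorphism premise stays open: it is discharged for the given p, q and
    again for competing sizes p', q'.\<close>
  note energy = DSO_energy_complete_bipartite[OF assms(1) _ assms(3,4), folded assms(5)]
  have n: "n = p + q"
    using energy(1)[OF iso] .
  have E: "DSO_energy G vs = e p q"
    using energy(2)[OF iso] by (simp add: e_def)
  have le_iff: "e p q \<le> e p' q' \<longleftrightarrow> p * q \<le> p' * q'"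
      "e p' q' \<le> e p q \<longleftrightarrow> p' * q' \<le> p * q" if "n = p' + q'" for p' q'
  proof -
    have s: "p + q = p' + q'" "real p' + q' = real p + q"
      using that n by linarith+
    show "e p q \<le> e p' q' \<longleftrightarrow> p * q \<le> p' * q'" "e p' q' \<le> e p q \<longleftrightarrow> p' * q' \<le> p * q"
      using pq mult_sum_squares_le_iff[OF s(1)] mult_sum_squares_le_iff[OF s(1)[symmetric]]
      by (simp_all add: e_def s(2) divide_simps)
  qed
  \<comment> \<open>This settles both equality cases: equal energies force equal products, hence the
    same unordered pair of sizes; conversely the sizes determine the energy.\<close>
  have iso_iff: "e p q = e p' q' \<longleftrightarrow> digraph_iso G (complete_bipartite_graph p' q')"
    if n': "n = p' + q'" for p' q'
  proof
    assume "e p q = e p' q'"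
    then have "p * q = p' * q'"
      using le_iff[OF n'] by simp
    then have "p = p' \<and> q = q' \<or> p = q' \<and> q = p'"
      using eq_pair_if_sum_prod_eq n n' by metis
    then show "digraph_iso G (complete_bipartite_graph p' q')"
      using iso digraph_iso_complete_bipartite_graph_commute[OF assms(1)] by blast
  next
    assume "digraph_iso G (complete_bipartite_graph p' q')"
    from energy(2)[OF this] show "e p q = e p' q'"
      by (simp add: E e_def)
  qed
  define a where "a = nat \<lceil>real n / 2\<rceil>"
  define b where "b = nat \<lfloor>real n / 2\<rfloor>"
  have a: "real_of_int \<lceil>real n / 2\<rceil> = a" and b: "real_of_int \<lfloor>real n / 2\<rfloor> = b"
    by (simp_all add: a_def b_def)
  have ab: "n = a + b" and ba: "a = b \<or> a = b + 1"
    unfolding a_def b_def by linarith+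
  have n1: "n = 1 + (n - 1)"
    using n pq by simp
  have L: "2 / real n * sqrt ((real n - 1) * ((real n)\<^sup>2 - 2 * real n + 2)) = e 1 (n - 1)"
  proof -
    have "real (n - 1) = real n - 1"
      using n1 by linarith
    then show ?thesis
      by (simp add: e_def power2_eq_square algebra_simps)
  qed
  have R: "2 / real n * sqrt (real a ^ 3 * b + a * real b ^ 3) = e a b"
    by (simp add: e_def ab power2_eq_square power3_eq_cube algebra_simps)
  have "1 * (n - 1) \<le> p * q"
  proof -
    \<comment> \<open>The truncated subtractions are exact since p and q are at least 1.\<close>
    have "(p - 1) * (q - 1) + (n - 1) = p * q"
      using pq n by (cases p; cases q) auto
    then show ?thesis
      by simp
  qed
  moreover have "p * q \<le> a * b"
  proof -
    have q: "int q = int a + b - p"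
      using ab n by linarith
    \<comment> \<open>With q eliminated, the difference is a quadratic in p with roots a and b. It
      is nonnegative because no integer lies strictly between b and a.\<close>
    have "int a * b - int p * q = (int p - a) * (int p - b)"
      unfolding q by (simp add: algebra_simps)
    also have "\<dots> \<ge> 0"
      using ba by (auto simp: zero_le_mult_iff)
    finally show ?thesis
      by (simp flip: of_nat_mult)
  qed
  ultimately have "e 1 (n - 1) \<le> e p q" "e p q \<le> e a b"
    using le_iff(2)[OF n1] le_iff(1)[OF ab] by blast+
  moreover have "e 1 (n - 1) = e p q \<longleftrightarrow> digraph_iso G (complete_bipartite_graph 1 (n - 1))"
    unfolding iso_iff[OF n1, symmetric] by (rule eq_commute)
  ultimately show ?thesis
    unfolding Let_def a b L R E a_def[symmetric] b_def[symmetric]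
    using iso_iff[OF ab] by blast
qed

end
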